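(* Let $\mathcal{Q}$ be an $((n,M,d;c))$ EA-CWS code. Then its spectrum $\mathrm{Sp}(\mathcal{Q})$ is a subset of $\{0,\pm1\}$.
   Context: Let $I,\sigma_x,\sigma_y,\sigma_z$ be the $2\times2$ identity and the Pauli matrices, $\mathcal{E}^m=\{\sigma_1\otimes\cdots\otimes\sigma_m:\sigma_i\in\{I,\sigma_x,\sigma_y,\sigma_z\}\}$, and $\mathcal{P}^m=\{\mathbf{i}^k\alpha: k\in\{0,1,2,3\},\alpha\in\mathcal{E}^m\}$ with $\mathbf{i}=\sqrt{-1}$. The weight of a Pauli operator is its number of non-identity tensor factors. An operator $E\in\mathcal{E}^{n+c}$ is detectable by a subspace $\mathcal{Q}\subset\mathbb{C}^{2^{n+c}}$ if, for an orthonormal basis $\{|v_i\rangle\}$ of $\mathcal{Q}$, $\langle v_i|E|v_i\rangle=\langle v_j|E|v_j\rangle$ for all $i,j$ and $\langle v_i|E|v_j\rangle=0$ for $i\ne j$. An $((n,M,d;c))$ EA (entanglement-assisted) quantum code is an $M$-dimensional subspace $\mathcal{Q}\subset\mathbb{C}^{2^n}\otimes\mathbb{C}^{2^c}$ such that (1) for every unit vector $|v\rangle\in\mathcal{Q}$, $\mathrm{Tr}_{\mathbb{C}^{2^n}}(|v\rangle\langle v|)=I^{\otimes c}/2^c$; and (2) $\alpha\otimes I^{\otimes c}$ is detectable by $\mathcal{Q}$ for all $\alpha\in\mathcal{E}^n$ of weight at most $d-1$, but not for all $\alpha$ of weight $d$. A stabilizer group is an abelian subgroup of $\mathcal{P}^{n+c}$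 not containing minus the identity; a CWS group is a maximal one, and $|S\rangle$ denotes the unit vector (unique up to phase) fixed by all elements of $S$. An EA quantum code $\mathcal{Q}$ is an EA-CWS code if there are a CWS group $S\subset\mathcal{P}^{n+c}$ and a set of $M$ pairwise commuting operators $W=\{\omega_1=I^{\otimes n},\omega_2,\dots,\omega_M\}\subset\mathcal{P}^n$ such that $\{(\omega_j\otimes I^{\otimes c})|S\rangle\}_{j=1}^M$ is an orthonormal basis of $\mathcal{Q}$. With $P$ the orthogonal projector onto $\mathcal{Q}$, for real $j\in[-1,1]$ set $S_j^{n,c}=\{\beta\in\mathcal{E}^n:P(\beta\otimes I^{\otimes c})P=jP\}$. The spectrum of $\mathcal{Q}$ is $\mathrm{Sp}(\mathcal{Q})=\{j:S_j^{n,c}\neq\emptyset\}$. *)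

theory Defs
  imports "Jordan_Normal_Form.VS_Connect"
begin

section \<open>Tensor products and Pauli operators\<close>

text \<open>
  The spaces \<open>\<complex>\<^bsup>2^n\<^esup> \<otimes> \<complex>\<^bsup>2^c\<^esup>\<close> and \<open>\<complex>\<^bsup>2^(n+c)\<^esup>\<close> are identified by sending
  \<open>e\<^sub>k \<otimes> e\<^sub>i\<close> to \<open>e\<^sub>m\<close> with \<open>m = k * 2^c + i\<close> (indices start at 0).
\<close>

definition kron :: "complex mat \<Rightarrow> complex mat \<Rightarrow> complex mat" where
  "kron A B = mat (dim_row A * dim_row B) (dim_col A * dim_col B)
     (\<lambda>(i, j). A $$ (i div dim_row B, j div dim_col B) * B $$ (i mod dim_row B, j mod dim_col B))"

fun tensor_list :: "complex mat list \<Rightarrow> complex mat" where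
  "tensor_list [] = 1\<^sub>m 1"
| "tensor_list (A # As) = kron A (tensor_list As)"

definition sigma_x :: "complex mat" where
  "sigma_x = mat_of_rows_list 2 [[0, 1], [1, 0]]"

definition sigma_y :: "complex mat" where
  "sigma_y = mat_of_rows_list 2 [[0, - \<i>], [\<i>, 0]]"

definition sigma_z :: "complex mat" where
  "sigma_z = mat_of_rows_list 2 [[1, 0], [0, - 1]]"

definition pauli_factors :: "nat \<Rightarrow> complex mat list set" where
  "pauli_factors m = {\<sigma>. length \<sigma> = m \<and> set \<sigma> \<subseteq> {1\<^sub>m 2, sigma_x, sigma_y, sigma_z}}"

definition pauli_ops :: "nat \<Rightarrow> complex mat set" where
  "pauli_ops m = tensor_list ` pauli_factors m"

definition pauli_phased :: "nat \<Rightarrow> complex mat set" where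
  "pauli_phased m = {\<i> ^ k \<cdot>\<^sub>m \<alpha> | k \<alpha>. k \<in> {0, 1, 2, 3} \<and> \<alpha> \<in> pauli_ops m}"

text \<open>
  The weight is read off from the factors; an operator in \<open>pauli_ops m\<close>
  has exactly one factorization in \<open>pauli_factors m\<close>.
\<close>

definition pauli_weight :: "complex mat list \<Rightarrow> nat" where
  "pauli_weight \<sigma> = length (filter (\<lambda>A. A \<noteq> 1\<^sub>m 2) \<sigma>)"

definition pauli_group :: "nat \<Rightarrow> complex mat monoid" where
  "pauli_group m = \<lparr>carrier = pauli_phased m, monoid.mult = (*), one = 1\<^sub>m (2 ^ m)\<rparr>"


section \<open>Subspaces, orthonormal bases and projectors\<close>

abbreviation hilbert :: "nat \<Rightarrow> (complex, complex vec) module" where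
  "hilbert N \<equiv> module_vec TYPE(complex) N"

text \<open>
  \<open>v \<bullet>c w\<close> is conjugate-linear in its second argument, so the bracket
  \<open>\<langle>v|A|w\<rangle>\<close> is \<open>(A *\<^sub>v w) \<bullet>c v\<close>.
\<close>

definition orthonormal_basis :: "nat \<Rightarrow> complex vec set \<Rightarrow> complex vec list \<Rightarrow> bool" where
  "orthonormal_basis N Q vs \<longleftrightarrow>
     vectorspace.basis class_ring ((hilbert N)\<lparr>carrier := Q\<rparr>) (set vs) \<and>
     (\<forall>i < length vs. \<forall>j < length vs. vs ! i \<bullet>c vs ! j = (if i = j then 1 else 0))"

definition is_orth_projector :: "nat \<Rightarrow> complex vec set \<Rightarrow> complex mat \<Rightarrow> bool" where
  "is_orth_projector N Q P \<longleftrightarrow> P \<in> carrier_mat N N \<and>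
     (\<forall>v \<in> carrier_vec N. P *\<^sub>v v \<in> Q \<and> (\<forall>w \<in> Q. (v - P *\<^sub>v v) \<bullet>c w = 0))"

definition orth_projector :: "nat \<Rightarrow> complex vec set \<Rightarrow> complex mat" where
  "orth_projector N Q = (THE P. is_orth_projector N Q P)"

definition ket_bra :: "complex vec \<Rightarrow> complex mat" where
  "ket_bra v = mat (dim_vec v) (dim_vec v) (\<lambda>(i, j). v $ i * cnj (v $ j))"

definition partial_trace_fst :: "nat \<Rightarrow> nat \<Rightarrow> complex mat \<Rightarrow> complex mat" where
  "partial_trace_fst n c A =
     mat (2 ^ c) (2 ^ c) (\<lambda>(i, j). \<Sum>k < 2 ^ n. A $$ (k * 2 ^ c + i, k * 2 ^ c + j))"


section \<open>Entanglement-assisted quantum codes\<close>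

definition detectable :: "nat \<Rightarrow> complex vec set \<Rightarrow> complex mat \<Rightarrow> bool" where
  "detectable m Q E \<longleftrightarrow> (\<exists>vs. orthonormal_basis (2 ^ m) Q vs \<and>
     (\<forall>i < length vs. \<forall>j < length vs.
        (E *\<^sub>v vs ! i) \<bullet>c vs ! i = (E *\<^sub>v vs ! j) \<bullet>c vs ! j \<and>
        (i \<noteq> j \<longrightarrow> (E *\<^sub>v vs ! j) \<bullet>c vs ! i = 0)))"

text \<open>
  Weight at most \<open>d - 1\<close> is written as weight below \<open>d\<close>, because subtraction
  on natural numbers is truncated.
\<close>

definition ea_code :: "nat \<Rightarrow> nat \<Rightarrow> nat \<Rightarrow> nat \<Rightarrow> complex vec set \<Rightarrow> bool" where
  "ea_code n M d c Q \<longleftrightarrow>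
     VectorSpace.subspace class_ring Q (hilbert (2 ^ (n + c))) \<and>
     vectorspace.dim class_ring ((hilbert (2 ^ (n + c)))\<lparr>carrier := Q\<rparr>) = M \<and>
     (\<forall>v \<in> Q. v \<bullet>c v = 1 \<longrightarrow>
        partial_trace_fst n c (ket_bra v) = (1 / 2 ^ c) \<cdot>\<^sub>m 1\<^sub>m (2 ^ c)) \<and>
     (\<forall>\<sigma> \<in> pauli_factors n. pauli_weight \<sigma> < d \<longrightarrow>
        detectable (n + c) Q (kron (tensor_list \<sigma>) (1\<^sub>m (2 ^ c)))) \<and>
     \<not> (\<forall>\<sigma> \<in> pauli_factors n. pauli_weight \<sigma> = d \<longrightarrow>
        detectable (n + c) Q (kron (tensor_list \<sigma>) (1\<^sub>m (2 ^ c))))"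

definition stabilizer_group :: "nat \<Rightarrow> complex mat set \<Rightarrow> bool" where
  "stabilizer_group m S \<longleftrightarrow> subgroup S (pauli_group m) \<and>
     (\<forall>g \<in> S. \<forall>h \<in> S. g * h = h * g) \<and> - 1\<^sub>m (2 ^ m) \<notin> S"

definition cws_group :: "nat \<Rightarrow> complex mat set \<Rightarrow> bool" where
  "cws_group m S \<longleftrightarrow> stabilizer_group m S \<and>
     (\<forall>T. stabilizer_group m T \<and> S \<subseteq> T \<longrightarrow> T = S)"

definition stabilizer_state :: "nat \<Rightarrow> complex mat set \<Rightarrow> complex vec \<Rightarrow> bool" where
  "stabilizer_state m S s \<longleftrightarrow> s \<in> carrier_vec (2 ^ m) \<and> s \<bullet>c s = 1 \<and> (\<forall>g \<in> S. g *\<^sub>v s = s)"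

text \<open>
  The state of a CWS group is unique only up to a phase, and the condition below
  does not depend on that phase. The entries of \<open>ws\<close> are distinct, since they
  yield an orthonormal list.
\<close>

definition ea_cws_code :: "nat \<Rightarrow> nat \<Rightarrow> nat \<Rightarrow> nat \<Rightarrow> complex vec set \<Rightarrow> bool" where
  "ea_cws_code n M d c Q \<longleftrightarrow> ea_code n M d c Q \<and>
     (\<exists>S s ws. cws_group (n + c) S \<and> stabilizer_state (n + c) S s \<and>
        length ws = M \<and> ws \<noteq> [] \<and> hd ws = 1\<^sub>m (2 ^ n) \<and> set ws \<subseteq> pauli_phased n \<and>
        (\<forall>\<omega> \<in> set ws. \<forall>\<omega>' \<in> set ws. \<omega> * \<omega>' = \<omega>' * \<omega>) \<and>
        orthonormal_basis (2 ^ (n + c)) Q (map (\<lambda>\<omega>. kron \<omega> (1\<^sub>m (2 ^ c)) *\<^sub>v s) ws))"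

definition spectral_set :: "nat \<Rightarrow> nat \<Rightarrow> complex vec set \<Rightarrow> real \<Rightarrow> complex mat set" where
  "spectral_set n c Q j =
     {\<beta> \<in> pauli_ops n.
        orth_projector (2 ^ (n + c)) Q * kron \<beta> (1\<^sub>m (2 ^ c)) * orth_projector (2 ^ (n + c)) Q
        = complex_of_real j \<cdot>\<^sub>m orth_projector (2 ^ (n + c)) Q}"

definition code_spectrum :: "nat \<Rightarrow> nat \<Rightarrow> complex vec set \<Rightarrow> real set" where
  "code_spectrum n c Q = {j \<in> {-1..1}. spectral_set n c Q j \<noteq> {}}"

end

theory Submission
  imports Defs
begin

text \<open>
  Since \<open>\<omega>\<^sub>1 = I\<close>, the stabilizer state \<open>s\<close> lies in \<open>Q\<close>, so \<open>P E P = j P\<close> with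
  \<open>E = \<beta> \<otimes> I\<close> forces \<open>j = \<langle>s|E|s\<rangle>\<close>. If \<open>E\<close> anticommutes with some \<open>g \<in> S\<close>, then
  \<open>\<langle>s|E|s\<rangle> = \<langle>gs|Egs\<rangle> = - \<langle>gs|gEs\<rangle> = - \<langle>s|E|s\<rangle>\<close>, hence \<open>j = 0\<close>.
  Otherwise \<open>E\<close> commutes with all of \<open>S\<close>, and by maximality of \<open>S\<close> either \<open>E \<in> S\<close>
  or \<open>-I \<in> E S\<close>; in both cases \<open>s\<close> is an eigenvector of \<open>E\<close> with eigenvalue \<open>1\<close> or \<open>-1\<close>.
\<close>

section \<open>Kronecker products\<close>

text \<open>Division with remainder by \<open>b\<close> puts the indices below \<open>a * b\<close>
  in bijection with pairs, so a summand that separates into quotient and remainder makes the sum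
  factor. Matrix multiplication of Kronecker products rests on this.\<close>

lemma sum_div_mod:
  fixes f g :: "nat \<Rightarrow> 'a::semiring_0"
  shows "(\<Sum>k<a * b. f (k div b) * g (k mod b)) = (\<Sum>i<a. f i) * (\<Sum>j<b. g j)"
proof -
  have "(\<Sum>i<a. f i) * (\<Sum>j<b. g j) = (\<Sum>(i, j)\<in>{..<a} \<times> {..<b}. f i * g j)"
    by (simp add: sum_product sum.cartesian_product)
  also have "\<dots> = (\<Sum>k<a * b. f (k div b) * g (k mod b))"
  proof (rule sum.reindex_bij_witness[of _ "\<lambda>k. (k div b, k mod b)" "\<lambda>(i, j). i * b + j"])
    fix p assume p: "p \<in> {..<a} \<times> {..<b}"
    then obtain i j where ij: "p = (i, j)" "i < a" "j < b" by auto
    have "Suc i * b \<le> a * b" using ij by (intro mult_right_mono) auto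
    then show "(case p of (i, j) \<Rightarrow> i * b + j) \<in> {..<a * b}" using ij by simp
  next
    fix k assume "k \<in> {..<a * b}"
    then show "(k div b, k mod b) \<in> {..<a} \<times> {..<b}"
      by (cases "b = 0") (auto simp: less_mult_imp_div_less)
  qed auto
  finally show ?thesis ..
qed

lemma dim_kron [simp]:
  "dim_row (kron A B) = dim_row A * dim_row B"
  "dim_col (kron A B) = dim_col A * dim_col B"
  by (simp_all add: kron_def)

lemma kron_carrier [simp]:
  "A \<in> carrier_mat n p \<Longrightarrow> B \<in> carrier_mat m q \<Longrightarrow> kron A B \<in> carrier_mat (n * m) (p * q)"
  by (intro carrier_matI) auto

lemma index_kron:
  "i < dim_row A * dim_row B \<Longrightarrow> j < dim_col A * dim_col B \<Longrightarrow>
    kron A B $$ (i, j) = A $$ (i div dim_row B, j div dim_col B) * B $$ (i mod dim_row B, j mod dim_col B)"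
  by (simp add: kron_def)

lemma mod_less_of_less_mult: "i < a * b \<Longrightarrow> i mod b < (b::nat)"
  by (cases "b = 0") auto

lemmas kron_bounds = less_mult_imp_div_less mod_less_of_less_mult

text \<open>The mixed-product rule: the summation index of the matrix product splits into a quotient
  and a remainder, and each summand separates accordingly. It reduces all algebra on Pauli strings
  to algebra on single factors.\<close>

lemma kron_mult:
  assumes "A \<in> carrier_mat n p" "B \<in> carrier_mat m r" "C \<in> carrier_mat p q" "D \<in> carrier_mat r s"
  shows "kron A B * kron C D = kron (A * C) (B * D)"
proof (rule eq_matI)
  fix i j assume "i < dim_row (kron (A * C) (B * D))" "j < dim_col (kron (A * C) (B * D))"
  then have ij: "i < n * m" "j < q * s" using assms by auto
  have "(kron A B * kron C D) $$ (i, j) =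
      (\<Sum>k<p * r. kron A B $$ (i, k) * kron C D $$ (k, j))"
    using assms ij by (simp add: scalar_prod_def atLeast0LessThan)
  also have "\<dots> = (\<Sum>k<p * r. (A $$ (i div m, k div r) * C $$ (k div r, j div s)) *
      (B $$ (i mod m, k mod r) * D $$ (k mod r, j mod s)))"
    using assms ij by (intro sum.cong) (auto simp: index_kron mult_ac)
  also have "\<dots> = (\<Sum>k<p. A $$ (i div m, k) * C $$ (k, j div s)) *
      (\<Sum>k<r. B $$ (i mod m, k) * D $$ (k, j mod s))"
    by (rule sum_div_mod)
  also have "\<dots> = kron (A * C) (B * D) $$ (i, j)"
    using assms ij by (simp add: index_kron scalar_prod_def atLeast0LessThan kron_bounds)
  finally show "(kron A B * kron C D) $$ (i, j) = kron (A * C) (B * D) $$ (i, j)" .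
qed (use assms in auto)

lemma kron_smult: "kron (a \<cdot>\<^sub>m A) (b \<cdot>\<^sub>m B) = (a * b) \<cdot>\<^sub>m kron A B"
  by (rule eq_matI) (auto simp: index_kron kron_bounds)

text \<open>An index of a triple product has three mixed-radix digits, and both bracketings read off
  the same ones. The local facts \<open>div\<close>, \<open>div_mod\<close> and
  \<open>mod_mod\<close> identify the first, second and third digit.\<close>

lemma kron_assoc: "kron (kron A B) C = kron A (kron B C)"
proof (rule eq_matI)
  have div: "i div (b * c) = i div c div b" for i b c :: nat
    by (metis div_mult2_eq mult.commute)
  have div_mod: "i mod (b * c) div c = i div c mod b" if "i < a * (b * c)" for i a b c :: nat
    using that by (cases "c = 0") (simp_all add: mult.commute[of b c] mod_mult2_eq)
  have mod_mod: "i mod (b * c) mod c = i mod c" for i b c :: nat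
    by (simp add: mod_mod_cancel)
  fix i j
  assume "i < dim_row (kron A (kron B C))" "j < dim_col (kron A (kron B C))"
  then have ij: "i < dim_row A * (dim_row B * dim_row C)" "j < dim_col A * (dim_col B * dim_col C)"
    by simp_all
  then have "i div dim_row C < dim_row A * dim_row B" "j div dim_col C < dim_col A * dim_col B"
    by (simp_all add: less_mult_imp_div_less mult.assoc)
  with ij show "kron (kron A B) C $$ (i, j) = kron A (kron B C) $$ (i, j)"
    by (simp add: index_kron kron_bounds div div_mod[OF ij(1)] div_mod[OF ij(2)] mod_mod mult.assoc)
qed (simp_all add: mult.assoc)

lemma one_smult_mat: "(1::'a::monoid_mult) \<cdot>\<^sub>m A = A"
  by (rule eq_matI) auto

lemma kron_one_left: "kron (1\<^sub>m 1) A = A"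
  by (rule eq_matI) (auto simp: index_kron)

lemma kron_one_one: "kron (1\<^sub>m n) (1\<^sub>m m) = 1\<^sub>m (n * m)"
proof (rule eq_matI)
  fix i j assume "i < dim_row (1\<^sub>m (n * m))" "j < dim_col (1\<^sub>m (n * m))"
  moreover have "i = j \<longleftrightarrow> i div m = j div m \<and> i mod m = j mod m" by (metis div_mult_mod_eq)
  ultimately show "kron (1\<^sub>m n) (1\<^sub>m m) $$ (i, j) = 1\<^sub>m (n * m) $$ (i, j)"
    by (simp add: index_kron kron_bounds)
qed simp_all

lemma tensor_list_append: "tensor_list (xs @ ys) = kron (tensor_list xs) (tensor_list ys)"
  \<comment> \<open>The simplifier turns the dimension \<open>1\<close> into \<open>Suc 0\<close>,
    so \<open>kron_one_left\<close> must be brought into that form to match.\<close>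
  by (induction xs) (simp_all add: kron_one_left[simplified] kron_assoc)

lemma tensor_list_replicate_one: "tensor_list (replicate m (1\<^sub>m 2)) = 1\<^sub>m (2 ^ m)"
  by (induction m) (simp_all add: kron_one_one)

text \<open>Padding a string with \<open>c\<close> identity factors is the same as tensoring with
  the identity on the second system. This places the tested operator in the same Pauli group as the
  stabilizer group.\<close>

lemma kron_one_in_pauli_ops:
  assumes "\<beta> \<in> pauli_ops n"
  shows "kron \<beta> (1\<^sub>m (2 ^ c)) \<in> pauli_ops (n + c)"
proof -
  obtain \<sigma> where \<sigma>: "\<sigma> \<in> pauli_factors n" "\<beta> = tensor_list \<sigma>"
    using assms by (auto simp: pauli_ops_def)
  then have "kron \<beta> (1\<^sub>m (2 ^ c)) = tensor_list (\<sigma> @ replicate c (1\<^sub>m 2))"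
    by (simp add: tensor_list_append tensor_list_replicate_one)
  moreover have "\<sigma> @ replicate c (1\<^sub>m 2) \<in> pauli_factors (n + c)"
    using \<sigma> by (auto simp: pauli_factors_def)
  ultimately show ?thesis by (auto simp: pauli_ops_def)
qed

section \<open>Pauli operators\<close>

definition paulis :: "complex mat set" where
  "paulis = {1\<^sub>m 2, sigma_x, sigma_y, sigma_z}"

lemma pauli_ops_0: "pauli_ops 0 = {1\<^sub>m 1}"
  by (auto simp: pauli_ops_def pauli_factors_def)

text \<open>The recursion behind all inductions on \<open>m\<close> below: a property of Pauli
  strings follows once it holds for the four matrices in \<open>paulis\<close> and survives
  \<open>kron\<close>.\<close>

lemma pauli_ops_Suc: "pauli_ops (Suc m) = {kron A B | A B. A \<in> paulis \<and> B \<in> pauli_ops m}"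
proof (intro equalityI subsetI)
  fix X assume "X \<in> pauli_ops (Suc m)"
  then obtain \<sigma> where \<sigma>: "length \<sigma> = Suc m" "set \<sigma> \<subseteq> paulis" "X = tensor_list \<sigma>"
    by (auto simp: pauli_ops_def pauli_factors_def paulis_def)
  then show "X \<in> {kron A B | A B. A \<in> paulis \<and> B \<in> pauli_ops m}"
    by (cases \<sigma>) (auto simp: pauli_ops_def pauli_factors_def paulis_def)
next
  fix X assume "X \<in> {kron A B | A B. A \<in> paulis \<and> B \<in> pauli_ops m}"
  then obtain A \<sigma> where "A \<in> paulis" "\<sigma> \<in> pauli_factors m" "X = tensor_list (A # \<sigma>)"
    by (auto simp: pauli_ops_def)
  moreover from this have "A # \<sigma> \<in> pauli_factors (Suc m)"
    by (auto simp: pauli_factors_def paulis_def)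
  ultimately show "X \<in> pauli_ops (Suc m)" by (metis pauli_ops_def imageI)
qed

section \<open>Single-qubit Pauli matrices\<close>

lemma paulis_carrier: "A \<in> paulis \<Longrightarrow> A \<in> carrier_mat 2 2"
  by (auto simp: paulis_def sigma_x_def sigma_y_def sigma_z_def mat_of_rows_list_def)

text \<open>Naming the four entries lets \<open>mat2_mult\<close>, \<open>mat2_smult\<close> and
  \<open>mat2_eq_iff\<close> turn identities between Pauli matrices into scalar equations.\<close>

definition mat2 :: "'a \<Rightarrow> 'a \<Rightarrow> 'a \<Rightarrow> 'a \<Rightarrow> 'a mat" where
  "mat2 a b c d = mat_of_rows_list 2 [[a, b], [c, d]]"

lemma mat2_eqI:
  assumes "A \<in> carrier_mat 2 2" "A $$ (0, 0) = a" "A $$ (0, 1) = b" "A $$ (1, 0) = c" "A $$ (1, 1) = d"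
  shows "A = mat2 a b c d"
proof (rule eq_matI)
  fix i j assume "i < dim_row (mat2 a b c d)" "j < dim_col (mat2 a b c d)"
  then have "i = 0 \<or> i = 1" "j = 0 \<or> j = 1" by (auto simp: mat2_def mat_of_rows_list_def)
  with assms(2-) show "A $$ (i, j) = mat2 a b c d $$ (i, j)"
    by (auto simp: mat2_def mat_of_rows_list_def)
qed (use assms(1) in \<open>auto simp: mat2_def mat_of_rows_list_def\<close>)

lemma index_mat2:
  "mat2 a b c d $$ (0, 0) = a" "mat2 a b c d $$ (0, Suc 0) = b"
  "mat2 a b c d $$ (Suc 0, 0) = c" "mat2 a b c d $$ (Suc 0, Suc 0) = d"
  by (simp_all add: mat2_def mat_of_rows_list_def)

lemma mat2_carrier [simp]: "mat2 a b c d \<in> carrier_mat 2 2"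
  by (intro carrier_matI) (simp_all add: mat2_def mat_of_rows_list_def)

lemma mat2_mult:
  fixes a :: "'a::semiring_0"
  shows "mat2 a b c d * mat2 a' b' c' d' =
    mat2 (a * a' + b * c') (a * b' + b * d') (c * a' + d * c') (c * b' + d * d')"
  using mat2_carrier[of a b c d] mat2_carrier[of a' b' c' d']
  by (intro mat2_eqI)
    (auto simp: scalar_prod_def index_mat2 numeral_2_eq_2 simp del: mat2_carrier)

lemma mat2_smult: "k \<cdot>\<^sub>m mat2 a b c d = mat2 (k * a) (k * b) (k * c) (k * d)"
  using mat2_carrier[of a b c d]
  by (intro mat2_eqI) (auto simp: index_mat2 simp del: mat2_carrier)

lemma mat2_eq_iff: "mat2 a b c d = mat2 a' b' c' d' \<longleftrightarrow> a = a' \<and> b = b' \<and> c = c' \<and> d = d'"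
  by (metis index_mat2)

lemma pauli_mat2:
  "1\<^sub>m 2 = mat2 1 0 0 1" "sigma_x = mat2 0 1 1 0" "sigma_y = mat2 0 (- \<i>) \<i> 0" "sigma_z = mat2 1 0 0 (- 1)"
  by (rule mat2_eqI) (simp_all add: sigma_x_def sigma_y_def sigma_z_def mat2_def)

lemma paulis_involution: "A \<in> paulis \<Longrightarrow> A * A = 1\<^sub>m 2"
  by (auto simp: paulis_def pauli_mat2 mat2_mult)

lemma paulis_hermitian:
  "A \<in> paulis \<Longrightarrow> i < 2 \<Longrightarrow> j < 2 \<Longrightarrow> A $$ (j, i) = cnj (A $$ (i, j))"
  by (auto simp: paulis_def pauli_mat2 index_mat2 less_2_cases_iff)

lemma paulis_mult:
  assumes "A \<in> paulis" "B \<in> paulis"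
  obtains k C where "C \<in> paulis" "A * B = \<i> ^ k \<cdot>\<^sub>m C"
proof -
  \<comment> \<open>Equal factors, or a factor that is the identity, give phase 1; two different
    non-identity factors give the third matrix with phase i or -i, which is the cube of i. The phase
    -1 never arises.\<close>
  have "\<exists>k\<in>{0, 1, 3}. \<exists>C\<in>paulis. A * B = \<i> ^ k \<cdot>\<^sub>m C"
    using assms unfolding paulis_def
    by (elim insertE emptyE)
      (simp_all add: pauli_mat2 mat2_mult mat2_smult mat2_eq_iff power3_eq_cube)
  then show ?thesis using that by blast
qed

lemma paulis_commute_or_anticommute:
  assumes "A \<in> paulis" "B \<in> paulis"
  obtains e where "e \<in> {1, -1 :: complex}" "A * B = e \<cdot>\<^sub>m (B * A)"
proof -
  have "\<exists>e\<in>{1, -1}. A * B = e \<cdot>\<^sub>m (B * A)"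
    using assms by (auto simp: paulis_def pauli_mat2 mat2_mult mat2_smult mat2_eq_iff)
  then show ?thesis using that by blast
qed

section \<open>Pauli strings on m qubits\<close>

lemma pauli_ops_carrier: "\<alpha> \<in> pauli_ops m \<Longrightarrow> \<alpha> \<in> carrier_mat (2 ^ m) (2 ^ m)"
proof (induction m arbitrary: \<alpha>)
  case (Suc m)
  then obtain A B where "\<alpha> = kron A B" "A \<in> paulis" "B \<in> pauli_ops m"
    by (auto simp: pauli_ops_Suc)
  then show ?case using kron_carrier[OF paulis_carrier Suc.IH] by simp
qed (simp add: pauli_ops_0)

lemma one_in_pauli_ops: "1\<^sub>m (2 ^ m) \<in> pauli_ops m"
proof -
  have "replicate m (1\<^sub>m 2) \<in> pauli_factors m" by (auto simp: pauli_factors_def)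
  then show ?thesis by (metis imageI pauli_ops_def tensor_list_replicate_one)
qed

lemma pauli_ops_involution: "\<alpha> \<in> pauli_ops m \<Longrightarrow> \<alpha> * \<alpha> = 1\<^sub>m (2 ^ m)"
proof (induction m arbitrary: \<alpha>)
  case (Suc m)
  then obtain A B where AB: "\<alpha> = kron A B" "A \<in> paulis" "B \<in> pauli_ops m"
    by (auto simp: pauli_ops_Suc)
  note cs = paulis_carrier[OF AB(2)] pauli_ops_carrier[OF AB(3)]
  show ?case
    using kron_mult[OF cs cs] AB Suc.IH[OF AB(3)]
    by (simp add: paulis_involution kron_one_one)
qed (simp_all add: pauli_ops_0)

text \<open>An entry of a Kronecker product is a product of entries at the digits of the two
  indices, so conjugate symmetry passes from the factors to the product. The entrywise form is what
  \<open>hermitian_cscalar_prod\<close> expects.\<close>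

lemma pauli_ops_hermitian:
  "\<alpha> \<in> pauli_ops m \<Longrightarrow> i < 2 ^ m \<Longrightarrow> j < 2 ^ m \<Longrightarrow> \<alpha> $$ (j, i) = cnj (\<alpha> $$ (i, j))"
proof (induction m arbitrary: \<alpha> i j)
  case (Suc m)
  then obtain A B where AB: "\<alpha> = kron A B" "A \<in> paulis" "B \<in> pauli_ops m"
    by (auto simp: pauli_ops_Suc)
  note cs = paulis_carrier[OF AB(2)] pauli_ops_carrier[OF AB(3)]
  have "i div 2 ^ m < 2" "j div 2 ^ m < 2" "i mod 2 ^ m < 2 ^ m" "j mod 2 ^ m < 2 ^ m"
    using Suc.prems by (auto simp: less_mult_imp_div_less)
  then show ?case
    using Suc.prems cs AB paulis_hermitian[OF AB(2), of "i div 2 ^ m" "j div 2 ^ m"]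
      Suc.IH[OF AB(3), of "i mod 2 ^ m" "j mod 2 ^ m"]
    by (simp add: index_kron)
qed (simp_all add: pauli_ops_0)

text \<open>Phases of the factors multiply, so exponents of i add along the string. The exponent is
  left unbounded here; \<open>pauli_phasedI\<close> reduces it later.\<close>

lemma pauli_ops_mult:
  "\<alpha> \<in> pauli_ops m \<Longrightarrow> \<beta> \<in> pauli_ops m \<Longrightarrow> \<exists>k. \<exists>\<gamma>\<in>pauli_ops m. \<alpha> * \<beta> = \<i> ^ k \<cdot>\<^sub>m \<gamma>"
proof (induction m arbitrary: \<alpha> \<beta>)
  case (Suc m)
  then obtain A B C D where AB: "\<alpha> = kron A B" "A \<in> paulis" "B \<in> pauli_ops m"
    and CD: "\<beta> = kron C D" "C \<in> paulis" "D \<in> pauli_ops m"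
    by (auto simp: pauli_ops_Suc)
  obtain k F where F: "F \<in> paulis" "A * C = \<i> ^ k \<cdot>\<^sub>m F" using paulis_mult[OF AB(2) CD(2)] .
  obtain l G where G: "G \<in> pauli_ops m" "B * D = \<i> ^ l \<cdot>\<^sub>m G" using Suc.IH[OF AB(3) CD(3)] by auto
  have "\<alpha> * \<beta> = \<i> ^ (k + l) \<cdot>\<^sub>m kron F G"
    using kron_mult[OF paulis_carrier[OF AB(2)] pauli_ops_carrier[OF AB(3)]
        paulis_carrier[OF CD(2)] pauli_ops_carrier[OF CD(3)]]
    by (simp add: AB(1) CD(1) F G kron_smult power_add)
  moreover have "kron F G \<in> pauli_ops (Suc m)" using F G by (auto simp: pauli_ops_Suc)
  ultimately show ?case by blast
next
  case 0
  then have "\<alpha> * \<beta> = \<i> ^ 0 \<cdot>\<^sub>m 1\<^sub>m 1" by (simp add: pauli_ops_0 one_smult_mat)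
  then show ?case by (auto simp only: pauli_ops_0)
qed

text \<open>Each tensor position contributes a sign 1 or -1 when the order is exchanged, and the
  sign for the whole strings is the product of these.\<close>

lemma pauli_ops_commute_or_anticommute:
  "\<alpha> \<in> pauli_ops m \<Longrightarrow> \<beta> \<in> pauli_ops m \<Longrightarrow> \<exists>e\<in>{1, -1}. \<alpha> * \<beta> = e \<cdot>\<^sub>m (\<beta> * \<alpha>)"
proof (induction m arbitrary: \<alpha> \<beta>)
  case (Suc m)
  then obtain A B C D where AB: "\<alpha> = kron A B" "A \<in> paulis" "B \<in> pauli_ops m"
    and CD: "\<beta> = kron C D" "C \<in> paulis" "D \<in> pauli_ops m"
    by (auto simp: pauli_ops_Suc)
  obtain e where e: "e \<in> {1, -1}" "A * C = e \<cdot>\<^sub>m (C * A)"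
    using paulis_commute_or_anticommute[OF AB(2) CD(2)] .
  obtain f where f: "f \<in> {1, -1}" "B * D = f \<cdot>\<^sub>m (D * B)" using Suc.IH[OF AB(3) CD(3)] by auto
  note cs1 = paulis_carrier[OF AB(2)] pauli_ops_carrier[OF AB(3)]
  note cs2 = paulis_carrier[OF CD(2)] pauli_ops_carrier[OF CD(3)]
  have "\<alpha> * \<beta> = (e * f) \<cdot>\<^sub>m (\<beta> * \<alpha>)"
    by (simp only: AB(1) CD(1) kron_mult[OF cs1 cs2] kron_mult[OF cs2 cs1] e(2) f(2) kron_smult)
  moreover have "e * f \<in> {1, -1}" using e(1) f(1) by auto
  ultimately show ?case by blast
qed (simp_all add: pauli_ops_0 one_smult_mat)

section \<open>The Pauli group with phases\<close>

lemma pauli_phasedI: "\<alpha> \<in> pauli_ops m \<Longrightarrow> \<i> ^ k \<cdot>\<^sub>m \<alpha> \<in> pauli_phased m"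
proof -
  assume "\<alpha> \<in> pauli_ops m"
  \<comment> \<open>The fourth power of i is 1, so any exponent can be replaced by one of the four
    that \<open>pauli_phased\<close> admits.\<close>
  moreover have "\<i> ^ k = \<i> ^ (k mod 4)"
  proof -
    have "\<i> ^ k = \<i> ^ (4 * (k div 4) + k mod 4)" by simp
    also have "\<dots> = \<i> ^ (k mod 4)" unfolding power_add power_mult by simp
    finally show ?thesis .
  qed
  moreover have "k mod 4 = 0 \<or> k mod 4 = 1 \<or> k mod 4 = 2 \<or> k mod 4 = 3" by presburger
  then have "k mod 4 \<in> {0, 1, 2, 3}" by (simp only: insert_iff empty_iff simp_thms)
  ultimately show ?thesis
    unfolding pauli_phased_def mem_Collect_eq by (intro exI[of _ "k mod 4"] exI[of _ \<alpha>]) simp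
qed

lemma pauli_phasedE:
  assumes "g \<in> pauli_phased m"
  obtains k \<alpha> where "\<alpha> \<in> pauli_ops m" "g = \<i> ^ k \<cdot>\<^sub>m \<alpha>"
  using assms by (auto simp: pauli_phased_def)

lemma pauli_phased_carrier: "g \<in> pauli_phased m \<Longrightarrow> g \<in> carrier_mat (2 ^ m) (2 ^ m)"
  by (elim pauli_phasedE) (simp add: pauli_ops_carrier)

lemma pauli_ops_subset_phased: "\<alpha> \<in> pauli_ops m \<Longrightarrow> \<alpha> \<in> pauli_phased m"
  using pauli_phasedI[of \<alpha> m 0] by (simp add: one_smult_mat)

lemma smult_smult_mat:
  fixes A :: "'a::semigroup_mult mat"
  shows "a \<cdot>\<^sub>m (b \<cdot>\<^sub>m A) = (a * b) \<cdot>\<^sub>m A"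
  by (rule eq_matI) (auto simp: mult.assoc)

lemma smult_mult_smult:
  fixes A B :: "'a::comm_ring_1 mat"
  assumes "A \<in> carrier_mat n p" "B \<in> carrier_mat p q"
  shows "(a \<cdot>\<^sub>m A) * (b \<cdot>\<^sub>m B) = (a * b) \<cdot>\<^sub>m (A * B)"
  using assms mult_smult_assoc_mat[OF assms(1), of "b \<cdot>\<^sub>m B" q a] mult_smult_distrib[OF assms, of b]
  by (simp add: smult_smult_mat)

lemma group_pauli_group: "group (pauli_group m)"
proof (rule groupI)
  fix x y assume "x \<in> carrier (pauli_group m)" "y \<in> carrier (pauli_group m)"
  then obtain k \<alpha> l \<beta> where x: "\<alpha> \<in> pauli_ops m" "x = \<i> ^ k \<cdot>\<^sub>m \<alpha>"
    and y: "\<beta> \<in> pauli_ops m" "y = \<i> ^ l \<cdot>\<^sub>m \<beta>"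
    by (auto simp: pauli_group_def elim!: pauli_phasedE)
  obtain r \<gamma> where \<gamma>: "\<gamma> \<in> pauli_ops m" "\<alpha> * \<beta> = \<i> ^ r \<cdot>\<^sub>m \<gamma>"
    using pauli_ops_mult[OF x(1) y(1)] by auto
  have "x * y = \<i> ^ (k + l + r) \<cdot>\<^sub>m \<gamma>"
    using smult_mult_smult[OF pauli_ops_carrier[OF x(1)] pauli_ops_carrier[OF y(1)]]
    by (simp add: x(2) y(2) \<gamma>(2) smult_smult_mat power_add)
  then show "x \<otimes>\<^bsub>pauli_group m\<^esub> y \<in> carrier (pauli_group m)"
    using \<gamma>(1) by (simp add: pauli_group_def pauli_phasedI)
next
  show "\<one>\<^bsub>pauli_group m\<^esub> \<in> carrier (pauli_group m)"
    by (simp add: pauli_group_def one_in_pauli_ops pauli_ops_subset_phased)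
next
  fix x y z
  assume "x \<in> carrier (pauli_group m)" "y \<in> carrier (pauli_group m)" "z \<in> carrier (pauli_group m)"
  then show "x \<otimes>\<^bsub>pauli_group m\<^esub> y \<otimes>\<^bsub>pauli_group m\<^esub> z =
      x \<otimes>\<^bsub>pauli_group m\<^esub> (y \<otimes>\<^bsub>pauli_group m\<^esub> z)"
    using assoc_mult_mat[OF pauli_phased_carrier pauli_phased_carrier pauli_phased_carrier]
    by (simp add: pauli_group_def)
next
  fix x assume "x \<in> carrier (pauli_group m)"
  then have x: "x \<in> pauli_phased m" by (simp add: pauli_group_def)
  show "\<one>\<^bsub>pauli_group m\<^esub> \<otimes>\<^bsub>pauli_group m\<^esub> x = x"
    using pauli_phased_carrier[OF x] by (simp add: pauli_group_def)
  obtain k \<alpha> where \<alpha>: "\<alpha> \<in> pauli_ops m" "x = \<i> ^ k \<cdot>\<^sub>m \<alpha>" using x by (rule pauli_phasedE)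
  \<comment> \<open>The inverse of i^k \<alpha> is i^(3k) \<alpha>: the phases combine to a power of
    i^4 = 1, and \<alpha> is an involution.\<close>
  have "\<i> ^ (3 * k) * \<i> ^ k = (\<i> ^ 4) ^ k"
    by (simp only: power_add[symmetric] power_mult[symmetric]) simp
  then have "(\<i> ^ (3 * k) \<cdot>\<^sub>m \<alpha>) * x = 1\<^sub>m (2 ^ m)"
    using smult_mult_smult[OF pauli_ops_carrier[OF \<alpha>(1)] pauli_ops_carrier[OF \<alpha>(1)]]
    by (simp add: \<alpha>(2) pauli_ops_involution[OF \<alpha>(1)] one_smult_mat)
  then show "\<exists>y\<in>carrier (pauli_group m). y \<otimes>\<^bsub>pauli_group m\<^esub> x = \<one>\<^bsub>pauli_group m\<^esub>"
    using pauli_phasedI[OF \<alpha>(1), of "3 * k"] by (auto simp: pauli_group_def)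
qed

section \<open>Inner products and unitarity\<close>

lemma cscalar_prod_sum:
  fixes v w :: "complex vec"
  shows "dim_vec w = n \<Longrightarrow> v \<bullet>c w = (\<Sum>i<n. v $ i * cnj (w $ i))"
  by (simp add: scalar_prod_def atLeast0LessThan)

lemma mult_mat_vec_index_sum:
  "A \<in> carrier_mat n p \<Longrightarrow> v \<in> carrier_vec p \<Longrightarrow> i < n \<Longrightarrow>
    (A *\<^sub>v v) $ i = (\<Sum>j<p. A $$ (i, j) * v $ j)"
  by (simp add: scalar_prod_def atLeast0LessThan)

text \<open>Both sides expand to the same double sum: exchanging the order of summation and using
  conjugate symmetry of the entries moves the matrix to the other argument.\<close>

lemma hermitian_cscalar_prod:
  assumes A: "A \<in> carrier_mat n n" "\<And>i j. i < n \<Longrightarrow> j < n \<Longrightarrow> A $$ (j, i) = cnj (A $$ (i, j))"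
    and u: "u \<in> carrier_vec n" and v: "v \<in> carrier_vec n"
  shows "(A *\<^sub>v u) \<bullet>c v = u \<bullet>c (A *\<^sub>v v)"
proof -
  have "(A *\<^sub>v u) \<bullet>c v = (\<Sum>i<n. \<Sum>j<n. A $$ (i, j) * u $ j * cnj (v $ i))"
    using A(1) u v by (simp add: cscalar_prod_sum[of _ n] mult_mat_vec_index_sum sum_distrib_right
      del: index_mult_mat_vec)
  also have "\<dots> = (\<Sum>j<n. \<Sum>i<n. A $$ (i, j) * u $ j * cnj (v $ i))" by (rule sum.swap)
  also have "\<dots> = (\<Sum>j<n. \<Sum>i<n. u $ j * cnj (A $$ (j, i) * v $ i))"
  proof (intro sum.cong refl)
    fix i j assume "i \<in> {..<n}" "j \<in> {..<n}"
    then have "cnj (A $$ (j, i)) = A $$ (i, j)" using A(2)[of j i] by simp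
    then show "A $$ (i, j) * u $ j * cnj (v $ i) = u $ j * cnj (A $$ (j, i) * v $ i)" by simp
  qed
  also have "\<dots> = u \<bullet>c (A *\<^sub>v v)"
    using A(1) u v by (simp add: cscalar_prod_sum[of _ n] mult_mat_vec_index_sum sum_distrib_left
      del: index_mult_mat_vec)
  finally show ?thesis .
qed

lemma cscalar_prod_smult:
  fixes u v :: "complex vec"
  assumes "u \<in> carrier_vec n" "v \<in> carrier_vec n"
  shows "(a \<cdot>\<^sub>v u) \<bullet>c (b \<cdot>\<^sub>v v) = a * cnj b * (u \<bullet>c v)"
  using assms by (simp add: cscalar_prod_sum[of _ n] sum_distrib_left mult_ac)

lemma smult_mat_mult_vec:
  fixes A :: "'a::comm_ring_1 mat"
  assumes "A \<in> carrier_mat n p" "v \<in> carrier_vec p"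
  shows "(a \<cdot>\<^sub>m A) *\<^sub>v v = a \<cdot>\<^sub>v (A *\<^sub>v v)"
  using assms by (intro eq_vecI) auto

text \<open>The phase cancels against its conjugate. The remaining string is Hermitian and squares
  to the identity, so moving one copy across the inner product removes both.\<close>

lemma pauli_phased_unitary:
  assumes g: "g \<in> pauli_phased m" and u: "u \<in> carrier_vec (2 ^ m)" and v: "v \<in> carrier_vec (2 ^ m)"
  shows "(g *\<^sub>v u) \<bullet>c (g *\<^sub>v v) = u \<bullet>c v"
proof -
  obtain k \<alpha> where \<alpha>: "\<alpha> \<in> pauli_ops m" "g = \<i> ^ k \<cdot>\<^sub>m \<alpha>" using g by (rule pauli_phasedE)
  note c = pauli_ops_carrier[OF \<alpha>(1)]
  have "(g *\<^sub>v u) \<bullet>c (g *\<^sub>v v) = \<i> ^ k * cnj (\<i> ^ k) * ((\<alpha> *\<^sub>v u) \<bullet>c (\<alpha> *\<^sub>v v))"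
    unfolding \<alpha>(2) smult_mat_mult_vec[OF c u] smult_mat_mult_vec[OF c v]
    by (intro cscalar_prod_smult[of _ "2 ^ m"] mult_mat_vec_carrier[OF c] u v)
  \<comment> \<open>The product equals (i * (-i))^k, a power of 1.\<close>
  also have "\<i> ^ k * cnj (\<i> ^ k) = 1" by (simp flip: power_mult_distrib)
  also have "1 * ((\<alpha> *\<^sub>v u) \<bullet>c (\<alpha> *\<^sub>v v)) = (\<alpha> *\<^sub>v u) \<bullet>c (\<alpha> *\<^sub>v v)" by simp
  also have "\<dots> = u \<bullet>c (\<alpha> *\<^sub>v (\<alpha> *\<^sub>v v))"
    by (rule hermitian_cscalar_prod[OF c pauli_ops_hermitian[OF \<alpha>(1)] u mult_mat_vec_carrier[OF c v]])
  also have "\<alpha> *\<^sub>v (\<alpha> *\<^sub>v v) = v"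
    using assoc_mult_mat_vec[OF c c v] v by (simp add: pauli_ops_involution[OF \<alpha>(1)])
  finally show ?thesis .
qed

lemma uminus_mat_mult_vec:
  fixes A :: "'a::comm_ring_1 mat"
  assumes "A \<in> carrier_mat n p" "v \<in> carrier_vec p"
  shows "((-1) \<cdot>\<^sub>m A) *\<^sub>v v = - (A *\<^sub>v v)"
  using assms by (intro eq_vecI) auto

section \<open>Stabilizer states\<close>

text \<open>Because \<open>x\<close> commutes with \<open>S\<close> and squares to the identity,
  \<open>S\<close> and its coset multiply like even and odd elements: the facts \<open>left\<close>
  and \<open>right\<close> land in the coset, \<open>both\<close> lands in \<open>S\<close>, and
  \<open>inv\<close> keeps the coset closed under inverses.\<close>

lemma (in group) subgroup_adjoin_involution:
  assumes S: "subgroup S G" and x: "x \<in> carrier G" "x \<otimes> x = \<one>"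
    and comm: "\<And>g. g \<in> S \<Longrightarrow> x \<otimes> g = g \<otimes> x"
  shows "subgroup (S \<union> (\<otimes>) x ` S) G"
proof -
  note c = subgroup.mem_carrier[OF S]
  have left: "g \<otimes> (x \<otimes> h) = x \<otimes> (g \<otimes> h)" if "g \<in> S" "h \<in> S" for g h
  proof -
    have "g \<otimes> (x \<otimes> h) = (g \<otimes> x) \<otimes> h" using c[OF that(1)] c[OF that(2)] x(1) by (simp add: m_assoc)
    also have "g \<otimes> x = x \<otimes> g" using comm[OF that(1)] ..
    also have "(x \<otimes> g) \<otimes> h = x \<otimes> (g \<otimes> h)" using c[OF that(1)] c[OF that(2)] x(1) by (simp add: m_assoc)
    finally show ?thesis .
  qed
  have right: "(x \<otimes> g) \<otimes> h = x \<otimes> (g \<otimes> h)" if "g \<in> S" "h \<in> S" for g h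
    using c[OF that(1)] c[OF that(2)] x(1) by (simp add: m_assoc)
  have both: "(x \<otimes> g) \<otimes> (x \<otimes> h) = g \<otimes> h" if "g \<in> S" "h \<in> S" for g h
  proof -
    have "(x \<otimes> g) \<otimes> (x \<otimes> h) = x \<otimes> (g \<otimes> (x \<otimes> h))"
      using c[OF that(1)] c[OF that(2)] x(1) by (simp add: m_assoc)
    also have "\<dots> = (x \<otimes> x) \<otimes> (g \<otimes> h)"
      unfolding left[OF that] using c[OF that(1)] c[OF that(2)] x(1) by (simp add: m_assoc)
    finally show ?thesis using c[OF that(1)] c[OF that(2)] x(2) by simp
  qed
  have inv: "inv (x \<otimes> g) = x \<otimes> inv g" if "g \<in> S" for g
  proof -
    have "inv (x \<otimes> g) = inv g \<otimes> inv x" using c[OF that] x(1) by (simp add: inv_mult_group)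
    also have "inv x = x" using x by (simp add: inv_equality)
    also have "inv g \<otimes> x = x \<otimes> inv g" using comm[OF subgroup.m_inv_closed[OF S that]] ..
    finally show ?thesis .
  qed
  show ?thesis
  proof (rule subgroupI)
    show "S \<union> (\<otimes>) x ` S \<subseteq> carrier G" using x(1) c by auto
    show "S \<union> (\<otimes>) x ` S \<noteq> {}" using subgroup.one_closed[OF S] by auto
    show "inv a \<in> S \<union> (\<otimes>) x ` S" if "a \<in> S \<union> (\<otimes>) x ` S" for a
      using that
    proof (elim UnE imageE)
      fix g assume "g \<in> S" "a = x \<otimes> g"
      then show ?thesis using inv[of g] by (intro UnI2) (metis imageI subgroup.m_inv_closed[OF S])
    qed (intro UnI1 subgroup.m_inv_closed[OF S])
    show "a \<otimes> b \<in> S \<union> (\<otimes>) x ` S" if "a \<in> S \<union> (\<otimes>) x ` S" "b \<in> S \<union> (\<otimes>) x ` S" for a b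
      using that
    proof (elim UnE imageE)
      fix h assume "a \<in> S" "h \<in> S" "b = x \<otimes> h"
      then show ?thesis using left[of a h] by (intro UnI2) (metis imageI subgroup.m_closed[OF S])
    next
      fix g assume "g \<in> S" "b \<in> S" "a = x \<otimes> g"
      then show ?thesis using right[of g b] by (intro UnI2) (metis imageI subgroup.m_closed[OF S])
    next
      fix g h assume "g \<in> S" "h \<in> S" "a = x \<otimes> g" "b = x \<otimes> h"
      then show ?thesis using both[of g h] by (intro UnI1) (metis subgroup.m_closed[OF S])
    qed (intro UnI1 subgroup.m_closed[OF S])
  qed
qed

text \<open>The enlarged group against which maximality of a CWS group is tested. Minus the identity
  is excluded from \<open>S\<close> by the stabilizer condition and from the coset by
  \<open>minus_one\<close>.\<close>

lemma stabilizer_group_adjoin: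
  assumes S: "stabilizer_group m S" and E: "E \<in> pauli_ops m"
    and comm: "\<And>g. g \<in> S \<Longrightarrow> E * g = g * E"
    and minus_one: "- 1\<^sub>m (2 ^ m) \<notin> (*) E ` S"
  shows "stabilizer_group m (S \<union> (*) E ` S)"
proof -
  interpret group "pauli_group m" by (rule group_pauli_group)
  have sub: "subgroup S (pauli_group m)" and ab: "\<And>g h. g \<in> S \<Longrightarrow> h \<in> S \<Longrightarrow> g * h = h * g"
    and no: "- 1\<^sub>m (2 ^ m) \<notin> S"
    using S by (auto simp: stabilizer_group_def)
  have "subgroup (S \<union> (*) E ` S) (pauli_group m)"
    using subgroup_adjoin_involution[OF sub, of E] E comm
    by (simp add: pauli_group_def pauli_ops_subset_phased pauli_ops_involution)
  moreover have "a * b = b * a" if "a \<in> S \<union> (*) E ` S" "b \<in> S \<union> (*) E ` S" for a b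
  proof -
    note Ec = pauli_ops_carrier[OF E]
    have c: "g \<in> carrier_mat (2 ^ m) (2 ^ m)" if "g \<in> S" for g
      using subgroup.mem_carrier[OF sub that] by (simp add: pauli_group_def pauli_phased_carrier)
    have comm_right: "g * (E * h) = E * h * g" if "g \<in> S" "h \<in> S" for g h
    proof -
      \<comment> \<open>Both \<open>E\<close> and \<open>h\<close> commute with \<open>g\<close>, so
        \<open>g\<close> can be carried past them one at a time.\<close>
      have "g * (E * h) = E * g * h"
        using assoc_mult_mat[OF c[OF that(1)] Ec c[OF that(2)]] comm[OF that(1)] by simp
      also have "\<dots> = E * (h * g)" using assoc_mult_mat[OF Ec c[OF that(1)] c[OF that(2)]] ab that by simp
      also have "\<dots> = E * h * g" using assoc_mult_mat[OF Ec c[OF that(2)] c[OF that(1)]] by simp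
      finally show ?thesis .
    qed
    have comm_both: "E * g * (E * h) = E * h * (E * g)" if "g \<in> S" "h \<in> S" for g h
    proof -
      have "E * g * (E * h) = E * (g * (E * h))"
        using Ec c that by (intro assoc_mult_mat) auto
      also have "\<dots> = E * (E * h * g)" using comm_right that by simp
      also have "E * h * g = h * (E * g)"
        using comm_right[OF that(2,1)] ab[OF that] assoc_mult_mat[OF Ec c[OF that(1)] c[OF that(2)]]
          assoc_mult_mat[OF Ec c[OF that(2)] c[OF that(1)]] by simp
      also have "E * (h * (E * g)) = E * h * (E * g)"
        using Ec c that by (intro assoc_mult_mat[symmetric]) auto
      finally show ?thesis .
    qed
    note ab_mem = that
    consider "a \<in> S" "b \<in> S" | h where "a \<in> S" "h \<in> S" "b = E * h"
      | g where "g \<in> S" "b \<in> S" "a = E * g" | g h where "g \<in> S" "h \<in> S" "a = E * g" "b = E * h"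
      using ab_mem by (elim UnE imageE) simp_all
    then show ?thesis
    proof cases
      case 1 then show ?thesis by (rule ab)
    next
      case 2 then show ?thesis by (simp only: comm_right)
    next
      case 3 then show ?thesis by (simp only: comm_right)
    next
      case 4 then show ?thesis by (simp only: comm_both[of g h])
    qed
  qed
  ultimately show ?thesis using no minus_one by (auto simp: stabilizer_group_def)
qed

lemma stabilizer_state_expectation:
  assumes S: "cws_group m S" and s: "stabilizer_state m S s" and E: "E \<in> pauli_ops m"
  shows "(E *\<^sub>v s) \<bullet>c s \<in> {0, 1, -1}"
proof -
  have sc: "s \<in> carrier_vec (2 ^ m)" and s1: "s \<bullet>c s = 1" and fix_s: "\<And>g. g \<in> S \<Longrightarrow> g *\<^sub>v s = s"
    using s by (auto simp: stabilizer_state_def)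
  have st: "stabilizer_group m S"
    and max: "\<And>T. stabilizer_group m T \<Longrightarrow> S \<subseteq> T \<Longrightarrow> T = S"
    using S by (auto simp: cws_group_def)
  have sub: "subgroup S (pauli_group m)" using st by (simp add: stabilizer_group_def)
  have ph: "g \<in> pauli_phased m" if "g \<in> S" for g
    using subgroup.mem_carrier[OF sub that] by (simp add: pauli_group_def)
  note c = pauli_phased_carrier[OF ph] and Ec = pauli_ops_carrier[OF E]
  have Es: "E *\<^sub>v s \<in> carrier_vec (2 ^ m)" using Ec sc by simp
  show ?thesis
  proof (cases "\<forall>g\<in>S. E * g = g * E")
    case True
    have "E *\<^sub>v s = s \<or> E *\<^sub>v s = - s"
    proof (cases "- 1\<^sub>m (2 ^ m) \<in> (*) E ` S")
      case True
      then obtain g where g: "g \<in> S" "E * g = - 1\<^sub>m (2 ^ m)" by auto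
      \<comment> \<open>Since \<open>g\<close> fixes \<open>s\<close>, it may be inserted for free,
        and the product with \<open>E\<close> is then minus the identity.\<close>
      have "E *\<^sub>v s = (E * g) *\<^sub>v s" using assoc_mult_mat_vec[OF Ec c[OF g(1)] sc] fix_s[OF g(1)] by simp
      also have "\<dots> = - s" using sc by (simp add: g(2))
      finally show ?thesis ..
    next
      case False
      \<comment> \<open>Maximality makes the enlargement by \<open>E\<close> trivial; as
        \<open>S\<close> contains the identity, the coset contains \<open>E\<close> itself, which
        therefore lies in \<open>S\<close>.\<close>
      have "S \<union> (*) E ` S = S"
        using True False by (intro max stabilizer_group_adjoin st E) auto
      moreover have "E * 1\<^sub>m (2 ^ m) \<in> (*) E ` S"
        using subgroup.one_closed[OF sub] by (simp add: pauli_group_def)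
      ultimately have "E \<in> S" using Ec by auto
      then show ?thesis using fix_s by simp
    qed
    then show ?thesis using s1 sc by auto
  next
    case False
    then obtain g where g: "g \<in> S" "E * g \<noteq> g * E" by auto
    obtain k \<alpha> where \<alpha>: "\<alpha> \<in> pauli_ops m" "g = \<i> ^ k \<cdot>\<^sub>m \<alpha>" using ph[OF g(1)] by (rule pauli_phasedE)
    note ac = pauli_ops_carrier[OF \<alpha>(1)]
    obtain e where e: "e \<in> {1, -1}" "E * \<alpha> = e \<cdot>\<^sub>m (\<alpha> * E)"
      using pauli_ops_commute_or_anticommute[OF E \<alpha>(1)] by auto
    \<comment> \<open>The phase of \<open>g\<close> is a common scalar on both sides, so the sign
      \<open>e\<close> found for its string \<alpha> also governs \<open>g\<close>. As
      \<open>E\<close> and \<open>g\<close> do not commute, \<open>e\<close> must be -1.\<close>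
    have eg: "E * g = e \<cdot>\<^sub>m (g * E)"
      using mult_smult_distrib[OF Ec ac] mult_smult_assoc_mat[OF ac Ec]
      by (simp add: \<alpha>(2) e(2) smult_smult_mat mult.commute)
    with e(1) g(2) have "E * g = (-1) \<cdot>\<^sub>m (g * E)" by auto
    then have "E *\<^sub>v s = - (g *\<^sub>v (E *\<^sub>v s))"
      using assoc_mult_mat_vec[OF Ec c[OF g(1)] sc] assoc_mult_mat_vec[OF c[OF g(1)] Ec sc]
        fix_s[OF g(1)] uminus_mat_mult_vec[OF mult_carrier_mat[OF c[OF g(1)] Ec] sc] by simp
    moreover have "- (g *\<^sub>v (E *\<^sub>v s)) \<bullet>c s = - ((g *\<^sub>v (E *\<^sub>v s)) \<bullet>c s)"
      using c[OF g(1)] Es sc by (intro uminus_scalar_prod[of _ "2 ^ m", symmetric]) auto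
    \<comment> \<open>The right-hand \<open>s\<close> is rewritten as \<open>g\<close> applied to
      \<open>s\<close>, so that unitarity of \<open>g\<close> can cancel it from both arguments. The
      expectation then equals its own negative.\<close>
    ultimately have "(E *\<^sub>v s) \<bullet>c s = - ((g *\<^sub>v (E *\<^sub>v s)) \<bullet>c (g *\<^sub>v s))"
      using fix_s[OF g(1)] by simp
    also have "\<dots> = - ((E *\<^sub>v s) \<bullet>c s)"
      by (simp add: pauli_phased_unitary[OF ph[OF g(1)] Es sc])
    finally show ?thesis by simp
  qed
qed

section \<open>Orthogonal projectors\<close>

text \<open>Translates the abstract basis condition into coordinates, so that membership in
  \<open>Q\<close> can be handled by finite sums.\<close>

lemma orthonormal_basis_span:
  assumes Q: "VectorSpace.subspace class_ring Q (hilbert N)" and vs: "orthonormal_basis N Q vs"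
  shows "Q = {vec N (\<lambda>i. \<Sum>k<length vs. f k * vs ! k $ i) | f. True}"
proof -
  interpret vec_space "TYPE(complex)" N .
  have sub: "submodule class_ring Q V" using Q by (rule VectorSpace.subspace.submod)
  interpret W: vectorspace class_ring "V\<lparr>carrier := Q\<rparr>"
    using Q by (rule subspace_is_vs)
  have vsQ: "set vs \<subseteq> Q" and "W.span (set vs) = Q"
    using vs by (auto simp: orthonormal_basis_def W.basis_def)
  \<comment> \<open>The basis condition speaks of the span inside the module with carrier
    \<open>Q\<close>; it agrees with the span in the ambient space because \<open>Q\<close> is a
    submodule.\<close>
  then have span: "span (set vs) = Q" using span_li_not_depend(1)[OF vsQ sub] by simp
  have vsc: "set vs \<subseteq> carrier_vec N" using vsQ submodule.subset[OF sub] by auto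
  have lin: "lincomb_list f vs = vec N (\<lambda>i. \<Sum>k<length vs. f k * vs ! k $ i)" for f
  proof (rule eq_vecI)
    have nth: "vs ! k \<in> carrier_vec N" if "k < length vs" for k using vsc that by auto
    have d: "\<forall>x\<in>set (map (\<lambda>i. f i \<cdot>\<^sub>v vs ! i) [0..<length vs]). dim_vec x = N"
      using nth by auto
    show "dim_vec (lincomb_list f vs) = dim_vec (vec N (\<lambda>i. \<Sum>k<length vs. f k * vs ! k $ i))"
      unfolding lincomb_list_def using dim_sumlist[OF d] by simp
    fix i assume "i < dim_vec (vec N (\<lambda>i. \<Sum>k<length vs. f k * vs ! k $ i))"
    then have i: "i < N" by simp
    show "lincomb_list f vs $ i = vec N (\<lambda>i. \<Sum>k<length vs. f k * vs ! k $ i) $ i"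
      unfolding lincomb_list_def using sumlist_nth[OF d i] carrier_vecD[OF nth] i
      by (auto simp: atLeast0LessThan intro!: sum.cong)
  qed
  show ?thesis
    unfolding span[symmetric] span_list_as_span[OF vsc, symmetric] span_list_def lin by auto
qed

lemma hilbert_subspace_carrier:
  "VectorSpace.subspace class_ring Q (hilbert N) \<Longrightarrow> Q \<subseteq> carrier_vec N"
  using submodule.subset[OF VectorSpace.subspace.submod, of class_ring Q "hilbert N"]
  by (simp add: module_vec_simps)

lemma hilbert_subspace_minus:
  assumes Q: "VectorSpace.subspace class_ring Q (hilbert N)" and vw: "v \<in> Q" "w \<in> Q"
  shows "v - w \<in> Q"
proof -
  interpret vec_space "TYPE(complex)" N .
  have sub: "submodule class_ring Q V" using Q by (rule VectorSpace.subspace.submod)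
  have "(-1) \<cdot>\<^sub>v w \<in> Q" using submodule.smult_closed[OF sub, of "-1" w] vw by simp
  then have "v + (-1) \<cdot>\<^sub>v w \<in> Q" using submodule.m_closed[OF sub vw(1)] by simp
  moreover have "v \<in> carrier_vec N" "w \<in> carrier_vec N"
    using hilbert_subspace_carrier[OF Q] vw by auto
  then have "v + (-1) \<cdot>\<^sub>v w = v - w" by (intro eq_vecI) auto
  ultimately show ?thesis by simp
qed

lemma eq_vec_if_cscalar_prod_minus:
  fixes v w :: "complex vec"
  assumes "v \<in> carrier_vec N" "w \<in> carrier_vec N" "(v - w) \<bullet>c (v - w) = 0"
  shows "v = w"
proof (rule eq_vecI)
  have "v - w = 0\<^sub>v N" using assms conjugate_square_eq_0_vec[of "v - w" N] by simp
  then have "(v - w) $ i = 0" if "i < N" for i using that by simp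
  then show "v $ i = w $ i" if "i < dim_vec w" for i using that assms by simp
qed (use assms in auto)

text \<open>The difference of the two images of \<open>v\<close> lies in \<open>Q\<close>, and it is
  also the difference of two residuals orthogonal to \<open>Q\<close>. It is thus orthogonal to
  itself and vanishes; testing on unit vectors gives equality of the matrices.\<close>

lemma is_orth_projector_unique:
  assumes Q: "VectorSpace.subspace class_ring Q (hilbert N)"
    and P: "is_orth_projector N Q P" and R: "is_orth_projector N Q R"
  shows "P = R"
proof -
  have Pc: "P \<in> carrier_mat N N" and Rc: "R \<in> carrier_mat N N"
    using P R by (auto simp: is_orth_projector_def)
  have eq: "P *\<^sub>v v = R *\<^sub>v v" if v: "v \<in> carrier_vec N" for v
  proof -
    let ?w = "P *\<^sub>v v - R *\<^sub>v v"
    have Pv: "P *\<^sub>v v \<in> carrier_vec N" and Rv: "R *\<^sub>v v \<in> carrier_vec N" using Pc Rc v by auto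
    have wQ: "?w \<in> Q"
      using P R v by (intro hilbert_subspace_minus[OF Q]) (auto simp: is_orth_projector_def)
    have "(v - P *\<^sub>v v) \<bullet>c ?w = 0" "(v - R *\<^sub>v v) \<bullet>c ?w = 0"
      using P R v wQ by (auto simp: is_orth_projector_def)
    moreover have "a - b = (v - b) - (v - a)" if "a \<in> carrier_vec N" "b \<in> carrier_vec N" for a b
      using that v by (intro eq_vecI) auto
    from this[OF Pv Rv]
    have "?w \<bullet>c ?w = (v - R *\<^sub>v v) \<bullet>c ?w - (v - P *\<^sub>v v) \<bullet>c ?w"
      using Pv Rv v minus_scalar_prod_distrib[of "v - R *\<^sub>v v" N "v - P *\<^sub>v v" "conjugate ?w"] by simp
    ultimately show ?thesis using eq_vec_if_cscalar_prod_minus[OF Pv Rv] by simp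
  qed
  show ?thesis
  proof (rule eq_matI)
    fix i j assume "i < dim_row R" "j < dim_col R"
    then have ij: "i < N" "j < N" using Rc by auto
    have "(P *\<^sub>v unit_vec N j) $ i = (R *\<^sub>v unit_vec N j) $ i" by (simp add: eq)
    then show "P $$ (i, j) = R $$ (i, j)" using ij Pc Rc by simp
  qed (use Pc Rc in auto)
qed

lemma is_orth_projector_exists:
  assumes Q: "VectorSpace.subspace class_ring Q (hilbert N)" and vs: "orthonormal_basis N Q vs"
  shows "\<exists>P. is_orth_projector N Q P"
proof -
  \<comment> \<open>The sum of the rank-one projectors onto the basis vectors.\<close>
  define P where "P = mat N N (\<lambda>(i, j). \<Sum>k<length vs. vs ! k $ i * cnj (vs ! k $ j))"
  have Pc: "P \<in> carrier_mat N N" by (simp add: P_def)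
  have Q_eq: "Q = {vec N (\<lambda>i. \<Sum>k<length vs. f k * vs ! k $ i) | f. True}"
    by (rule orthonormal_basis_span[OF Q vs])
  interpret vec_space "TYPE(complex)" N .
  have "set vs \<subseteq> Q"
    using vs vectorspace.basis_def[OF subspace_is_vs[OF Q]] by (auto simp: orthonormal_basis_def)
  then have vsc: "vs ! k \<in> carrier_vec N" if "k < length vs" for k
    using that hilbert_subspace_carrier[OF Q] nth_mem by blast
  have orth: "vs ! k \<bullet>c vs ! l = (if k = l then 1 else 0)" if "k < length vs" "l < length vs" for k l
    using vs that by (auto simp: orthonormal_basis_def)
  have Pv: "P *\<^sub>v v = vec N (\<lambda>i. \<Sum>k<length vs. (v \<bullet>c vs ! k) * vs ! k $ i)"
    if v: "v \<in> carrier_vec N" for v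
  proof (rule eq_vecI)
    fix i assume "i < dim_vec (vec N (\<lambda>i. \<Sum>k<length vs. (v \<bullet>c vs ! k) * vs ! k $ i))"
    then have i: "i < N" by simp
    have "(P *\<^sub>v v) $ i = (\<Sum>j<N. \<Sum>k<length vs. vs ! k $ i * cnj (vs ! k $ j) * v $ j)"
      using mult_mat_vec_index_sum[OF Pc v i] i by (simp add: P_def sum_distrib_right)
    also have "\<dots> = (\<Sum>k<length vs. \<Sum>j<N. vs ! k $ i * cnj (vs ! k $ j) * v $ j)"
      by (rule sum.swap)
    also have "\<dots> = (\<Sum>k<length vs. (v \<bullet>c vs ! k) * vs ! k $ i)"
      using vsc by (intro sum.cong refl) (simp add: cscalar_prod_sum[of _ N] sum_distrib_left sum_distrib_right mult_ac)
    finally show "(P *\<^sub>v v) $ i = vec N (\<lambda>i. \<Sum>k<length vs. (v \<bullet>c vs ! k) * vs ! k $ i) $ i"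
      using i by simp
  qed (simp add: P_def)
  \<comment> \<open>Orthonormality recovers the coefficients of a linear combination. Applied to
    \<open>Pv\<close>, it shows that a vector and its image have the same coefficients.\<close>
  have comb: "vec N (\<lambda>i. \<Sum>k<length vs. f k * vs ! k $ i) \<bullet>c vs ! l = f l"
    if l: "l < length vs" for f l
  proof -
    have "vec N (\<lambda>i. \<Sum>k<length vs. f k * vs ! k $ i) \<bullet>c vs ! l =
        (\<Sum>i<N. \<Sum>k<length vs. f k * vs ! k $ i * cnj (vs ! l $ i))"
      using vsc[OF l] by (simp add: cscalar_prod_sum[of _ N] sum_distrib_right)
    also have "\<dots> = (\<Sum>k<length vs. \<Sum>i<N. f k * vs ! k $ i * cnj (vs ! l $ i))" by (rule sum.swap)
    also have "\<dots> = (\<Sum>k<length vs. f k * (vs ! k \<bullet>c vs ! l))"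
      using vsc[OF l] by (simp add: cscalar_prod_sum[of _ N] sum_distrib_left mult_ac)
    also have "\<dots> = (\<Sum>k<length vs. if k = l then f k else 0)"
      using l by (intro sum.cong) (auto simp: orth)
    finally show ?thesis using l by simp
  qed
  have "(v - P *\<^sub>v v) \<bullet>c w = 0" if v: "v \<in> carrier_vec N" and w: "w \<in> Q" for v w
  proof -
    obtain f where f: "w = vec N (\<lambda>i. \<Sum>k<length vs. f k * vs ! k $ i)" using w Q_eq by auto
    \<comment> \<open>By conjugate linearity, orthogonality to \<open>Q\<close> only has to be
      checked on the basis vectors.\<close>
    have z: "(v - P *\<^sub>v v) \<bullet>c vs ! k = 0" if "k < length vs" for k
    proof -
      have "(v - P *\<^sub>v v) \<bullet>c vs ! k = v \<bullet>c vs ! k - (P *\<^sub>v v) \<bullet>c vs ! k"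
        using v Pc vsc[OF that] by (intro minus_scalar_prod_distrib[of _ N]) auto
      then show ?thesis using comb[OF that] by (simp add: Pv[OF v])
    qed
    have "(v - P *\<^sub>v v) \<bullet>c w =
        (\<Sum>i<N. \<Sum>k<length vs. (v - P *\<^sub>v v) $ i * cnj (f k * vs ! k $ i))"
      by (simp add: f cscalar_prod_sum[of _ N] sum_distrib_left)
    also have "\<dots> = (\<Sum>k<length vs. \<Sum>i<N. (v - P *\<^sub>v v) $ i * cnj (f k * vs ! k $ i))"
      by (rule sum.swap)
    also have "\<dots> = (\<Sum>k<length vs. cnj (f k) * ((v - P *\<^sub>v v) \<bullet>c vs ! k))"
      using vsc by (intro sum.cong refl) (simp add: cscalar_prod_sum[of _ N] sum_distrib_left mult_ac)
    finally show ?thesis by (simp add: z)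
  qed
  moreover have "P *\<^sub>v v \<in> Q" if "v \<in> carrier_vec N" for v
    unfolding Q_eq Pv[OF that] by (intro CollectI exI[of _ "\<lambda>k. v \<bullet>c vs ! k"]) simp
  ultimately show ?thesis using Pc by (auto simp: is_orth_projector_def)
qed

text \<open>\<open>orth_projector\<close> is a definite description, so unique existence is required
  before its defining property can be used.\<close>

lemma orth_projector_is_orth_projector:
  assumes "VectorSpace.subspace class_ring Q (hilbert N)" "orthonormal_basis N Q vs"
  shows "is_orth_projector N Q (orth_projector N Q)"
  unfolding orth_projector_def
proof (rule theI')
  show "\<exists>!P. is_orth_projector N Q P"
    using is_orth_projector_exists[OF assms] is_orth_projector_unique[OF assms(1)] by blast
qed

lemma is_orth_projector_cscalar_prod:
  assumes P: "is_orth_projector N Q P" and v: "v \<in> carrier_vec N" and w: "w \<in> Q" "w \<in> carrier_vec N"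
  shows "(P *\<^sub>v v) \<bullet>c w = v \<bullet>c w"
proof -
  have "P \<in> carrier_mat N N" "(v - P *\<^sub>v v) \<bullet>c w = 0"
    using P v w by (auto simp: is_orth_projector_def)
  moreover have "(v - P *\<^sub>v v) \<bullet>c w = v \<bullet>c w - (P *\<^sub>v v) \<bullet>c w"
    using v w calculation(1) by (intro minus_scalar_prod_distrib[of _ N]) auto
  ultimately show ?thesis by simp
qed

text \<open>The residual of \<open>w\<close> is orthogonal to \<open>Q\<close> and, as a difference
  of elements of \<open>Q\<close>, also belongs to \<open>Q\<close>; hence it has norm zero.\<close>

lemma is_orth_projector_fixes:
  assumes Q: "VectorSpace.subspace class_ring Q (hilbert N)"
    and P: "is_orth_projector N Q P" and w: "w \<in> Q"
  shows "P *\<^sub>v w = w"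
proof -
  have wc: "w \<in> carrier_vec N" using hilbert_subspace_carrier[OF Q] w by auto
  have "P \<in> carrier_mat N N" "P *\<^sub>v w \<in> Q" and orth: "\<And>u. u \<in> Q \<Longrightarrow> (w - P *\<^sub>v w) \<bullet>c u = 0"
    using P wc by (auto simp: is_orth_projector_def)
  then have "(w - P *\<^sub>v w) \<bullet>c (w - P *\<^sub>v w) = 0" "P *\<^sub>v w \<in> carrier_vec N"
    using hilbert_subspace_minus[OF Q w] hilbert_subspace_carrier[OF Q] by auto
  then show ?thesis using eq_vec_if_cscalar_prod_minus[OF wc, of "P *\<^sub>v w"] by simp
qed

section \<open>The spectrum of EA-CWS codes\<close>

theorem lemma20:
  fixes n M d c :: nat and Q :: "complex vec set"
  assumes "ea_cws_code n M d c Q"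
  shows "code_spectrum n c Q \<subseteq> {0, 1, -1}"
proof
  define N where "N = (2::nat) ^ (n + c)"
  define P where "P = orth_projector N Q"
  have Q: "VectorSpace.subspace class_ring Q (hilbert N)"
    using assms by (simp add: ea_cws_code_def ea_code_def N_def)
  obtain S s ws where S: "cws_group (n + c) S" and s: "stabilizer_state (n + c) S s"
    and ws: "ws \<noteq> []" "hd ws = 1\<^sub>m (2 ^ n)"
    and basis: "orthonormal_basis N Q (map (\<lambda>\<omega>. kron \<omega> (1\<^sub>m (2 ^ c)) *\<^sub>v s) ws)"
    using assms by (auto simp: ea_cws_code_def N_def)
  have sc: "s \<in> carrier_vec N" and s1: "s \<bullet>c s = 1" using s by (auto simp: stabilizer_state_def N_def)
  have "set (map (\<lambda>\<omega>. kron \<omega> (1\<^sub>m (2 ^ c)) *\<^sub>v s) ws) \<subseteq> Q"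
    using basis vectorspace.basis_def[OF vectorspace.subspace_is_vs[OF vec_vs Q]]
    by (auto simp: orthonormal_basis_def)
  moreover have "1\<^sub>m (2 ^ n) \<in> set ws" using ws by (metis hd_in_set)
  \<comment> \<open>The basis vector belonging to the first word operator is the stabilizer state
    itself.\<close>
  ultimately have "kron (1\<^sub>m (2 ^ n)) (1\<^sub>m (2 ^ c)) *\<^sub>v s \<in> Q" by auto
  then have sQ: "s \<in> Q" using sc by (simp add: kron_one_one N_def power_add)
  have P: "is_orth_projector N Q P"
    unfolding P_def by (rule orth_projector_is_orth_projector[OF Q basis])
  then have Pc: "P \<in> carrier_mat N N" by (simp add: is_orth_projector_def)
  have Ps: "P *\<^sub>v s = s" by (rule is_orth_projector_fixes[OF Q P sQ])
  fix j assume "j \<in> code_spectrum n c Q"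
  then obtain \<beta> where \<beta>: "\<beta> \<in> pauli_ops n"
    and eq: "P * kron \<beta> (1\<^sub>m (2 ^ c)) * P = complex_of_real j \<cdot>\<^sub>m P"
    by (auto simp: code_spectrum_def spectral_set_def P_def N_def)
  let ?E = "kron \<beta> (1\<^sub>m (2 ^ c))"
  have E: "?E \<in> pauli_ops (n + c)" by (rule kron_one_in_pauli_ops[OF \<beta>])
  have Ec: "?E \<in> carrier_mat N N" using pauli_ops_carrier[OF E] by (simp add: N_def)
  have "P *\<^sub>v (?E *\<^sub>v s) = (P * ?E * P) *\<^sub>v s"
    using assoc_mult_mat_vec[OF Pc Ec sc] assoc_mult_mat_vec[OF mult_carrier_mat[OF Pc Ec] Pc sc]
    by (simp add: Ps)
  also have "\<dots> = complex_of_real j \<cdot>\<^sub>v s"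
    by (simp add: eq smult_mat_mult_vec[OF Pc sc] Ps)
  \<comment> \<open>Pairing with \<open>s\<close>, which lies in \<open>Q\<close>, removes the outer
    projector, so the expectation of \<open>?E\<close> at the unit vector \<open>s\<close> is the
    spectral value.\<close>
  finally have "(?E *\<^sub>v s) \<bullet>c s = (complex_of_real j \<cdot>\<^sub>v s) \<bullet>c s"
    using is_orth_projector_cscalar_prod[OF P _ sQ sc, of "?E *\<^sub>v s"] Ec sc by simp
  also have "\<dots> = complex_of_real j" using sc s1 by simp
  finally have "complex_of_real j \<in> {0, 1, -1}"
    using stabilizer_state_expectation[OF S s E] by simp
  \<comment> \<open>All members are written as embedded reals, so that injectivity of the embedding
    brings the claim back to the reals.\<close>
  then have "complex_of_real j \<in> {complex_of_real 0, complex_of_real 1, complex_of_real (-1)}" by simp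
  then show "j \<in> {0, 1, -1}" by (simp only: insert_iff empty_iff of_real_eq_iff)
qed

end
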